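(* Let $k\ge 1$, let $n$ be a non-negative integer, and let $x_1,\dots,x_{k+1}$ be non-negative integers. Then $$\Big[\sum_{i=1}^{k+1}x_i\Big]_{n}=\sum \genfrac{[}{]}{0pt}{}{n}{r_1,r_2,\ldots,r_k}\,\tau_1^{\sum_{j=1}^{k}r_j(z_j-(n-s_j))}\,\tau_2^{\sum_{j=1}^{k}(n-s_j)(x_j-r_j)}\prod_{j=1}^{k+1}[x_j]_{r_j}$$ and $$\Big[\sum_{i=1}^{k+1}x_i\Big]_{n}=\sum \genfrac{[}{]}{0pt}{}{n}{r_1,r_2,\ldots,r_k}\,\tau_2^{\sum_{j=1}^{k}r_j(z_j-(n-s_j))}\,\tau_1^{\sum_{j=1}^{k}(n-s_j)(x_j-r_j)}\prod_{j=1}^{k+1}[x_j]_{r_j},$$ where both sums run over all $(r_1,\dots,r_k)$ with $r_j\in\{0,1,\dots,n\}$ and $\sum_{i=1}^k r_i\le n$, and where $s_j=\sum_{i=1}^{j}r_i$, $z_j=\sum_{i=j+1}^{k+1}x_i$ for $j\in\{1,\dots,k\}$, and $r_{k+1}=n-s_k$.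
   Context: $\mathcal R(p,q)$-deformed numbers: fix parameters $0<q<p<1$ and a function $\mathcal R$ such that $[x]=[x]_{\mathcal R(p,q)}:=\mathcal R(p^x,q^x)=\dfrac{\tau_1^x-\tau_2^x}{\tau_1-\tau_2}$, where $\tau_1\ne\tau_2$ are real numbers depending on $p,q$. Only $\tau_1,\tau_2$ matter here: they are nonzero distinct reals such that $[x]>0$ for every integer $x\ge1$, and the formula for $[x]$ is used for all integers $x$. Deformed factorial: $[r]!=[1][2]\cdots[r]$, $[0]!=1$. Deformed falling factorial of order $r\ge0$: $[x]_{r}=[x]_{r,\mathcal R(p,q)}=\prod_{i=0}^{r-1}[x-i]$, with $[x]_0=1$. Deformed multinomial coefficient: $$\genfrac{[}{]}{0pt}{}{x}{r_1,\ldots,r_k}=\frac{[x]_{r_1+\cdots+r_k}}{[r_1]!\cdots[r_k]!}.$$ *)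

theory Defs
  imports Complex_Main "HOL-Library.FuncSet"
begin

definition deformed_number :: "(real \<Rightarrow> real \<Rightarrow> real) \<Rightarrow> real \<Rightarrow> real \<Rightarrow> int \<Rightarrow> real" where
  "deformed_number R p q x = R (p powi x) (q powi x)"

definition deformed_fact :: "(real \<Rightarrow> real \<Rightarrow> real) \<Rightarrow> real \<Rightarrow> real \<Rightarrow> nat \<Rightarrow> real" where
  "deformed_fact R p q r = (\<Prod>i=1..r. deformed_number R p q (int i))"

definition deformed_falling :: "(real \<Rightarrow> real \<Rightarrow> real) \<Rightarrow> real \<Rightarrow> real \<Rightarrow> int \<Rightarrow> nat \<Rightarrow> real" where
  "deformed_falling R p q x r = (\<Prod>i<r. deformed_number R p q (x - int i))"

definition deformed_multinomial ::
    "(real \<Rightarrow> real \<Rightarrow> real) \<Rightarrow> real \<Rightarrow> real \<Rightarrow> int \<Rightarrow> nat \<Rightarrow> (nat \<Rightarrow> nat) \<Rightarrow> real" where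
  "deformed_multinomial R p q x k r =
     deformed_falling R p q x (\<Sum>j=1..k. r j) / (\<Prod>j=1..k. deformed_fact R p q (r j))"

text \<open>Tuples are functions on 1-based indices. The tuples \<open>(r\<^sub>1, \<dots>, r\<^sub>k)\<close> are taken
  extensional, so that each of them is counted exactly once when summing over this set.\<close>

definition index_tuples :: "nat \<Rightarrow> nat \<Rightarrow> (nat \<Rightarrow> nat) set" where
  "index_tuples k n = {r \<in> {1..k} \<rightarrow>\<^sub>E {0..n}. (\<Sum>i=1..k. r i) \<le> n}"

definition head_sum :: "(nat \<Rightarrow> nat) \<Rightarrow> nat \<Rightarrow> nat" where
  "head_sum r j = (\<Sum>i=1..j. r i)"

definition tail_sum :: "nat \<Rightarrow> (nat \<Rightarrow> nat) \<Rightarrow> nat \<Rightarrow> nat" where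
  "tail_sum k x j = (\<Sum>i=j+1..k+1. x i)"

text \<open>The tuple extended by the entry \<open>r\<^bsub>k+1\<^esub> = n - s\<^sub>k\<close>; the subtraction does not truncate
  on \<open>index_tuples k n\<close>.\<close>

definition completed_tuple :: "nat \<Rightarrow> nat \<Rightarrow> (nat \<Rightarrow> nat) \<Rightarrow> nat \<Rightarrow> nat" where
  "completed_tuple k n r = r(k + 1 := n - head_sum r k)"

end

theory Submission
  imports Defs
begin

text \<open>
  The case \<open>k = 1\<close> is the deformed Vandermonde formula. It follows by induction on \<open>n\<close>:
  the last factor of \<open>[x + y]\<^bsub>n+1\<^esub>\<close> splits as
  \<open>[x + y - n] = \<tau>\<^sub>1\<^bsup>y-n+r\<^esup> [x - r] + \<tau>\<^sub>2\<^bsup>x-r\<^esup> [y - n + r]\<close> in the \<open>r\<close>-th term, and the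
  resulting coefficients recombine by the Pascal recurrence. The general case follows by induction
  on \<open>k\<close>, merging \<open>x\<^bsub>k+1\<^esub>\<close> and \<open>x\<^bsub>k+2\<^esub>\<close> into one summand and expanding the last
  factor \<open>[x\<^bsub>k+1\<^esub> + x\<^bsub>k+2\<^esub>]\<^bsub>n-s\<^sub>k\<^esub>\<close> by the Vandermonde formula; the induction can start at
  \<open>k = 0\<close>. The two claimed formulas are exchanged by swapping \<open>\<tau>\<^sub>1\<close> and \<open>\<tau>\<^sub>2\<close>.
\<close>

text \<open>The assumptions survive an exchange of \<open>t\<close> and \<open>u\<close>, since
  numerator and denominator in \<open>number_eq\<close> both change sign; one proof thus serves both
  formulas.\<close>

locale deformed =
  fixes R :: "real \<Rightarrow> real \<Rightarrow> real" and p q t u :: real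
  assumes t_nz: "t \<noteq> 0" and u_nz: "u \<noteq> 0" and t_neq_u: "t \<noteq> u"
    and number_eq: "\<And>m :: int. deformed_number R p q m = (t powi m - u powi m) / (t - u)"
    and number_nz: "\<And>m :: int. m \<ge> 1 \<Longrightarrow> deformed_number R p q m \<noteq> 0"
begin

section \<open>Deformed numbers, factorials and binomial coefficients\<close>

abbreviation "num \<equiv> deformed_number R p q"
abbreviation "fall \<equiv> deformed_falling R p q"
abbreviation "dfact \<equiv> deformed_fact R p q"

definition binom :: "int \<Rightarrow> nat \<Rightarrow> real" where
  "binom x r = fall x r / dfact r"

text \<open>Subtract and add \<open>t powi b * u powi a\<close> in the numerator of the left
  side.\<close>

lemma number_add: "num (a + b) = t powi b * num a + u powi a * num b"
  using t_nz u_nz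
  by (simp add: number_eq power_int_add flip: add_divide_distrib) (simp add: algebra_simps)

lemma number_0: "num 0 = 0"
  by (simp add: number_eq)

lemma fall_0: "fall x 0 = 1"
  by (simp add: deformed_falling_def)

lemma fall_Suc: "fall x (Suc r) = fall x r * num (x - int r)"
  by (simp add: deformed_falling_def)

lemma fall_add: "fall x (r + s) = fall x r * fall (x - int r) s"
  by (induction s) (simp_all add: fall_0 fall_Suc algebra_simps)

lemma fall_Suc_left: "fall x (Suc r) = num x * fall (x - 1) r"
  using fall_add[of x 1 r] by (simp add: deformed_falling_def)

lemma dfact_Suc: "dfact (Suc r) = dfact r * num (int r + 1)"
  by (simp add: deformed_fact_def algebra_simps)

lemma dfact_nz: "dfact r \<noteq> 0"
  by (auto simp: deformed_fact_def number_nz)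

lemma binom_0: "binom x 0 = 1"
  by (simp add: binom_def fall_0 deformed_fact_def)

text \<open>The last factor of the falling factorial is [n - n] = [0]. This allows a sum up to
  \<open>n\<close> to be extended to \<open>Suc n\<close>.\<close>

lemma binom_eq_0: "binom (int n) (Suc n) = 0"
  by (simp add: binom_def fall_Suc number_0)

text \<open>All three falling factorials contain \<open>fall x r\<close>, so after clearing
  factorials it remains to split \<open>num (x + 1)\<close> along x + 1 = (x - r) + (r + 1).\<close>

lemma binom_Pascal:
  "binom (x + 1) (Suc r) = t powi (int r + 1) * binom x (Suc r) + u powi (x - int r) * binom x r"
proof -
  have "num (x + 1) = t powi (int r + 1) * num (x - int r) + u powi (x - int r) * num (int r + 1)"
    using number_add[of "x - int r" "int r + 1"] by simp
  moreover have "num (int r + 1) \<noteq> 0"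
    by (simp add: number_nz)
  ultimately show ?thesis
    using dfact_nz[of r] unfolding binom_def fall_Suc_left[of "x + 1"] fall_Suc[of x] dfact_Suc
    by (simp add: field_simps)
qed

section \<open>The Vandermonde formula for two summands\<close>

definition vterm :: "int \<Rightarrow> int \<Rightarrow> nat \<Rightarrow> nat \<Rightarrow> real" where
  "vterm x y n r = t powi (int r * (y - (int n - int r))) * u powi ((int n - int r) * (x - int r))
     * fall x r * fall y (n - r)"

text \<open>After splitting the new factor, the part with \<open>num (x - int r)\<close> prolongs
  \<open>fall x r\<close> and the other part prolongs \<open>fall y (n - r)\<close>. The powers left
  over are the weights of \<open>binom_Pascal\<close>.\<close>

lemma vterm_number:
  assumes "r \<le> n"
  shows "vterm x y n r * num (x + y - int n)
    = t powi int r * vterm x y (Suc n) r + u powi (int n - int r) * vterm x y (Suc n) (Suc r)"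
proof -
  define d where "d = y - (int n - int r)"
  have num: "num (x + y - int n) = t powi d * num (x - int r) + u powi (x - int r) * num d"
    using number_add[of "x - int r" d] by (simp add: d_def algebra_simps)
  have y: "fall y (Suc n - r) = fall y (n - r) * num d"
    using assms by (simp add: Suc_diff_le fall_Suc d_def of_nat_diff)
  note t_add = power_int_add[OF disjI1[OF t_nz], symmetric]
  note u_add = power_int_add[OF disjI1[OF u_nz], symmetric]
  \<comment> \<open>Raising \<open>n\<close> alone lowers \<open>d\<close> by 1 and keeps x - r
    (\<open>1\<close> and \<open>3\<close>); raising \<open>n\<close> and \<open>r\<close> together
    keeps \<open>d\<close> and lowers x - r by 1 (\<open>2\<close> and \<open>4\<close>).\<close>
  have 1: "t powi int r * t powi (int r * (y - (int (Suc n) - int r))) = t powi (int r * d)"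
    unfolding d_def t_add by (simp add: algebra_simps)
  have 2: "t powi (int (Suc r) * (y - (int (Suc n) - int (Suc r)))) = t powi (int r * d) * t powi d"
    unfolding d_def t_add by (simp add: algebra_simps)
  have 3: "u powi ((int (Suc n) - int r) * (x - int r))
      = u powi ((int n - int r) * (x - int r)) * u powi (x - int r)"
    unfolding u_add by (simp add: algebra_simps)
  have 4: "u powi (int n - int r) * u powi ((int (Suc n) - int (Suc r)) * (x - int (Suc r)))
      = u powi ((int n - int r) * (x - int r))"
    unfolding u_add by (simp add: algebra_simps)
  have "t powi int r * vterm x y (Suc n) r
      = (t powi int r * t powi (int r * (y - (int (Suc n) - int r))))
        * u powi ((int (Suc n) - int r) * (x - int r)) * fall x r * fall y (Suc n - r)"
    by (simp only: vterm_def mult.assoc)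
  also have "\<dots> = t powi (int r * d) * u powi ((int n - int r) * (x - int r)) * fall x r
      * fall y (n - r) * (u powi (x - int r) * num d)"
    unfolding 1 3 y by (simp only: mult_ac)
  finally have 5: "t powi int r * vterm x y (Suc n) r = \<dots>" .
  have "u powi (int n - int r) * vterm x y (Suc n) (Suc r)
      = (u powi (int n - int r) * u powi ((int (Suc n) - int (Suc r)) * (x - int (Suc r))))
        * t powi (int (Suc r) * (y - (int (Suc n) - int (Suc r)))) * fall x (Suc r) * fall y (n - r)"
    by (simp only: vterm_def mult_ac diff_Suc_Suc)
  also have "\<dots> = t powi (int r * d) * u powi ((int n - int r) * (x - int r)) * fall x r
      * fall y (n - r) * (t powi d * num (x - int r))"
    unfolding 2 4 fall_Suc by (simp only: mult_ac)
  finally have 6: "u powi (int n - int r) * vterm x y (Suc n) (Suc r) = \<dots>" .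
  show ?thesis
    unfolding 5 6 num by (simp only: vterm_def flip: d_def) (simp only: distrib_left add.commute)
qed

lemma Vandermonde: "fall (x + y) n = (\<Sum>r\<le>n. binom (int n) r * vterm x y n r)"
proof (induction n)
  case 0
  show ?case by (simp add: fall_0 binom_0 vterm_def)
next
  case (Suc n)
  let ?U = "\<lambda>r. binom (int n) r * (t powi int r * vterm x y (Suc n) r)"
  let ?V = "\<lambda>r. binom (int n) r * (u powi (int n - int r) * vterm x y (Suc n) (Suc r))"
  have "fall (x + y) (Suc n) = (\<Sum>r\<le>n. binom (int n) r * (vterm x y n r * num (x + y - int n)))"
    by (simp only: fall_Suc Suc.IH sum_distrib_right mult.assoc)
  also have "\<dots> = (\<Sum>r\<le>n. ?U r + ?V r)"
    by (intro sum.cong refl) (simp add: vterm_number distrib_left)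
  also have "\<dots> = (\<Sum>r\<le>Suc n. ?U r) + (\<Sum>r\<le>n. ?V r)"
    by (simp add: sum.distrib binom_eq_0)
  \<comment> \<open>The shift pairs \<open>?U (Suc r)\<close> with \<open>?V r\<close>: both carry
    \<open>vterm x y (Suc n) (Suc r)\<close>, and their coefficients add up by the Pascal
    recurrence.\<close>
  also have "\<dots> = ?U 0 + (\<Sum>r\<le>n. ?U (Suc r) + ?V r)"
    unfolding sum.atMost_Suc_shift[of ?U] by (simp add: sum.distrib)
  also have "(\<Sum>r\<le>n. ?U (Suc r) + ?V r)
      = (\<Sum>r\<le>n. binom (int (Suc n)) (Suc r) * vterm x y (Suc n) (Suc r))"
    using binom_Pascal[of "int n"] by (intro sum.cong refl) (simp add: algebra_simps)
  also have "?U 0 + \<dots> = (\<Sum>r\<le>Suc n. binom (int (Suc n)) r * vterm x y (Suc n) r)"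
    unfolding sum.atMost_Suc_shift[of "\<lambda>r. binom (int (Suc n)) r * vterm x y (Suc n) r"]
    by (simp add: binom_0)
  finally show ?case .
qed

definition mterm :: "nat \<Rightarrow> nat \<Rightarrow> (nat \<Rightarrow> nat) \<Rightarrow> (nat \<Rightarrow> nat) \<Rightarrow> real" where
  "mterm k n x r = deformed_multinomial R p q (int n) k r
     * t powi (\<Sum>j=1..k. int (r j) * (int (tail_sum k x j) - (int n - int (head_sum r j))))
     * u powi (\<Sum>j=1..k. (int n - int (head_sum r j)) * (int (x j) - int (r j)))
     * (\<Prod>j=1..k+1. fall (int (x j)) (completed_tuple k n r j))"

end

section \<open>Appending an entry to an index tuple\<close>

lemma head_sum_upd: "j \<le> k \<Longrightarrow> head_sum (r(Suc k := m)) j = head_sum r j"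
  by (simp add: head_sum_def)

lemma head_sum_upd_Suc: "head_sum (r(Suc k := m)) (Suc k) = head_sum r k + m"
  by (simp add: head_sum_def)

lemma tail_sum_merge:
  "j \<le> k \<Longrightarrow> tail_sum k (x(Suc k := x (Suc k) + x (Suc (Suc k)))) j = tail_sum (Suc k) x j"
  by (simp add: tail_sum_def)

text \<open>The new entry \<open>m\<close> is limited only by what the first \<open>k\<close>
  entries leave of \<open>n\<close>; its own bound \<open>m \<le> n\<close> follows.\<close>

lemma sum_index_tuples_Suc:
  "(\<Sum>r\<in>index_tuples (Suc k) n. f r)
    = (\<Sum>r\<in>index_tuples k n. \<Sum>m\<le>n - head_sum r k. f (r(Suc k := m)))"
proof -
  have fin: "finite (index_tuples k n)"
    unfolding index_tuples_def by (rule finite_subset[of _ "{1..k} \<rightarrow>\<^sub>E {0..n}"]) (auto intro: finite_PiE)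
  have "(\<Sum>r\<in>index_tuples k n. \<Sum>m\<le>n - head_sum r k. f (r(Suc k := m)))
      = (\<Sum>(r, m)\<in>Sigma (index_tuples k n) (\<lambda>r. {..n - head_sum r k}). f (r(Suc k := m)))"
    using fin by (subst sum.Sigma) auto
  also have "\<dots> = (\<Sum>r\<in>index_tuples (Suc k) n. f r)"
  proof (rule sum.reindex_bij_witness[where
        i = "\<lambda>r. (r(Suc k := undefined), r (Suc k))" and j = "\<lambda>(r, m). r(Suc k := m)"])
    fix a assume a: "a \<in> Sigma (index_tuples k n) (\<lambda>r. {..n - head_sum r k})"
    obtain r m where am: "a = (r, m)" by fastforce
    have r: "r \<in> {1..k} \<rightarrow>\<^sub>E {0..n}" "head_sum r k \<le> n" "m \<le> n - head_sum r k"
      using a by (auto simp: am index_tuples_def head_sum_def)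
    \<comment> \<open>By extensionality, resetting position \<open>Suc k\<close> to
      \<open>undefined\<close> recovers the shorter tuple exactly.\<close>
    have "r (Suc k) = undefined"
      using r(1) by (intro PiE_arb[of r]) auto
    then show "((case a of (r, m) \<Rightarrow> r(Suc k := m))(Suc k := undefined),
        (case a of (r, m) \<Rightarrow> r(Suc k := m)) (Suc k)) = a"
      by (auto simp: am)
    show "(case a of (r, m) \<Rightarrow> r(Suc k := m)) \<in> index_tuples (Suc k) n"
      using r head_sum_upd_Suc[of r k m]
      by (auto simp: am index_tuples_def head_sum_def PiE_iff extensional_def)
    show "f (case a of (r, m) \<Rightarrow> r(Suc k := m)) = (case a of (r, m) \<Rightarrow> f (r(Suc k := m)))"
      by (simp add: am)
  next
    fix r assume r: "r \<in> index_tuples (Suc k) n"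
    then show "(case (r(Suc k := undefined), r (Suc k)) of (r, m) \<Rightarrow> r(Suc k := m)) = r"
      by simp
    have "head_sum (r(Suc k := undefined)) k = head_sum r k"
      by (rule head_sum_upd) simp
    then show "(r(Suc k := undefined), r (Suc k))
        \<in> Sigma (index_tuples k n) (\<lambda>r. {..n - head_sum r k})"
      using r by (auto simp: index_tuples_def head_sum_def PiE_iff extensional_def)
  qed
  finally show ?thesis by simp
qed

section \<open>The formula for any number of summands\<close>

context deformed
begin

text \<open>The factors at the last two positions are isolated: together they form a Vandermonde
  summand of order \<open>n - head_sum r k\<close>, and the rest does not depend on
  \<open>m\<close>.\<close>

lemma mterm_upd:
  assumes "head_sum r k + m \<le> n"
  shows "mterm (Suc k) n x (r(Suc k := m))
    = deformed_multinomial R p q (int n) k r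
      * t powi (\<Sum>j=1..k. int (r j) * (int (tail_sum (Suc k) x j) - (int n - int (head_sum r j))))
      * u powi (\<Sum>j=1..k. (int n - int (head_sum r j)) * (int (x j) - int (r j)))
      * (\<Prod>j=1..k. fall (int (x j)) (r j))
      * (binom (int (n - head_sum r k)) m
         * vterm (int (x (Suc k))) (int (x (Suc (Suc k)))) (n - head_sum r k) m)"
proof -
  let ?r = "r(Suc k := m)"
  let ?s = "head_sum r k"
  \<comment> \<open>By \<open>fall_add\<close>, the numerator of order s + m splits into orders s at
    n and m at n - s.\<close>
  have multinomial: "deformed_multinomial R p q (int n) (Suc k) ?r
      = deformed_multinomial R p q (int n) k r * binom (int (n - ?s)) m"
    using assms by (simp add: deformed_multinomial_def head_sum_def binom_def fall_add of_nat_diff)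
  have t: "(\<Sum>j=1..Suc k. int (?r j) * (int (tail_sum (Suc k) x j) - (int n - int (head_sum ?r j))))
      = (\<Sum>j=1..k. int (r j) * (int (tail_sum (Suc k) x j) - (int n - int (head_sum r j))))
        + int m * (int (x (Suc (Suc k))) - (int (n - ?s) - int m))"
    using assms
    by (simp add: head_sum_upd head_sum_upd_Suc of_nat_diff algebra_simps)
       (simp add: tail_sum_def)
  have u: "(\<Sum>j=1..Suc k. (int n - int (head_sum ?r j)) * (int (x j) - int (?r j)))
      = (\<Sum>j=1..k. (int n - int (head_sum r j)) * (int (x j) - int (r j)))
        + (int (n - ?s) - int m) * (int (x (Suc k)) - int m)"
    using assms by (simp add: head_sum_upd head_sum_upd_Suc of_nat_diff algebra_simps)
  have "(\<Prod>j=1..Suc k + 1. fall (int (x j)) (completed_tuple (Suc k) n ?r j))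
      = (\<Prod>j=1..k. fall (int (x j)) (r j)) * fall (int (x (Suc k))) m
        * fall (int (x (Suc (Suc k)))) (n - ?s - m)"
    by (simp add: completed_tuple_def head_sum_upd_Suc)
  then show ?thesis
    unfolding mterm_def vterm_def multinomial t u
    using t_nz u_nz by (simp add: power_int_add mult_ac)
qed

lemma multi_Vandermonde:
  "fall (int (\<Sum>i=1..k+1. x i)) n = (\<Sum>r\<in>index_tuples k n. mterm k n x r)"
proof (induction k arbitrary: x)
  case 0
  \<comment> \<open>Only the empty tuple remains, and its completing entry is \<open>n\<close>, so
    the sum is the single term \<open>fall (int (x 1)) n\<close>.\<close>
  have "index_tuples 0 n = {\<lambda>_. undefined}"
    by (simp add: index_tuples_def)
  then show ?case
    by (simp add: mterm_def deformed_multinomial_def fall_0 completed_tuple_def head_sum_def)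
next
  case (Suc k)
  let ?x = "x(Suc k := x (Suc k) + x (Suc (Suc k)))"
  have "fall (int (\<Sum>i=1..Suc k+1. x i)) n = fall (int (\<Sum>i=1..k+1. ?x i)) n"
    by (simp add: add.assoc)
  also have "\<dots> = (\<Sum>r\<in>index_tuples k n. mterm k n ?x r)"
    by (rule Suc.IH)
  also have "\<dots> = (\<Sum>r\<in>index_tuples k n. \<Sum>m\<le>n - head_sum r k. mterm (Suc k) n x (r(Suc k := m)))"
  proof (rule sum.cong[OF refl])
    fix r assume "r \<in> index_tuples k n"
    then have s: "head_sum r k \<le> n"
      by (simp add: index_tuples_def head_sum_def)
    \<comment> \<open>The merged entry occurs in the exponents only through tail sums, which merging
      preserves, so it can be expanded in the last falling factorial alone.\<close>
    have "mterm k n ?x r = deformed_multinomial R p q (int n) k r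
      * t powi (\<Sum>j=1..k. int (r j) * (int (tail_sum (Suc k) x j) - (int n - int (head_sum r j))))
      * u powi (\<Sum>j=1..k. (int n - int (head_sum r j)) * (int (x j) - int (r j)))
      * (\<Prod>j=1..k. fall (int (x j)) (r j))
      * fall (int (x (Suc k)) + int (x (Suc (Suc k)))) (n - head_sum r k)"
      by (simp add: mterm_def completed_tuple_def tail_sum_merge)
    also have "\<dots> = (\<Sum>m\<le>n - head_sum r k. mterm (Suc k) n x (r(Suc k := m)))"
      unfolding Vandermonde sum_distrib_left
      by (intro sum.cong refl mterm_upd[symmetric]) (use s in simp)
    finally show "mterm k n ?x r = \<dots>" .
  qed
  also have "\<dots> = (\<Sum>r\<in>index_tuples (Suc k) n. mterm (Suc k) n x r)"
    by (rule sum_index_tuples_Suc[symmetric])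
  finally show ?case .
qed

end

theorem theorem2p3:
  fixes R :: "real \<Rightarrow> real \<Rightarrow> real" and p q \<tau>1 \<tau>2 :: real
    and k n :: nat and x :: "nat \<Rightarrow> nat"
  assumes "0 < q" and "q < p" and "p < 1"
    and "\<tau>1 \<noteq> 0" and "\<tau>2 \<noteq> 0" and "\<tau>1 \<noteq> \<tau>2"
    and "\<And>m :: int. deformed_number R p q m = (\<tau>1 powi m - \<tau>2 powi m) / (\<tau>1 - \<tau>2)"
    and "\<And>m :: int. m \<ge> 1 \<Longrightarrow> deformed_number R p q m > 0"
    and "k \<ge> 1"
  shows "deformed_falling R p q (int (\<Sum>i=1..k+1. x i)) n =
      (\<Sum>r\<in>index_tuples k n.
         deformed_multinomial R p q (int n) k r
         * \<tau>1 powi (\<Sum>j=1..k. int (r j) * (int (tail_sum k x j) - (int n - int (head_sum r j))))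
         * \<tau>2 powi (\<Sum>j=1..k. (int n - int (head_sum r j)) * (int (x j) - int (r j)))
         * (\<Prod>j=1..k+1. deformed_falling R p q (int (x j)) (completed_tuple k n r j)))
    \<and> deformed_falling R p q (int (\<Sum>i=1..k+1. x i)) n =
      (\<Sum>r\<in>index_tuples k n.
         deformed_multinomial R p q (int n) k r
         * \<tau>2 powi (\<Sum>j=1..k. int (r j) * (int (tail_sum k x j) - (int n - int (head_sum r j))))
         * \<tau>1 powi (\<Sum>j=1..k. (int n - int (head_sum r j)) * (int (x j) - int (r j)))
         * (\<Prod>j=1..k+1. deformed_falling R p q (int (x j)) (completed_tuple k n r j)))"
proof -
  have nz: "\<And>m :: int. m \<ge> 1 \<Longrightarrow> deformed_number R p q m \<noteq> 0"
    using assms(8) by (metis less_irrefl)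
  interpret A: deformed R p q \<tau>1 \<tau>2
    by unfold_locales (use assms(4-7) nz in auto)
  interpret B: deformed R p q \<tau>2 \<tau>1
  proof unfold_locales
    show "deformed_number R p q m = (\<tau>2 powi m - \<tau>1 powi m) / (\<tau>2 - \<tau>1)" for m :: int
      unfolding assms(7) by (metis minus_diff_eq minus_divide_divide)
  qed (use assms(4-6) nz in auto)
  show ?thesis
    using A.multi_Vandermonde[of x k n] B.multi_Vandermonde[of x k n]
    unfolding A.mterm_def B.mterm_def by blast
qed

end
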